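(* Let $f:A\to B$ and $g:A\to C$ be homomorphisms of commutative rings and let $J\subseteq B$, $J'\subseteq C$ be ideals with $f^{-1}(J)=g^{-1}(J')$. If $\operatorname{Ann}_{g(A)+J'}(J')=0$, then $$\operatorname{Hom}_{A\bowtie^{f,g}(J,J')}\left(f(A)+J,\ A\bowtie^{f,g}(J,J')\right)\cong J\times 0$$ as $(f(A)+J)$-modules.
   Context: All rings are commutative with identity. The bi-amalgamation is the subring $A\bowtie^{f,g}(J,J')=\{(f(a)+j,\,g(a)+j') : a\in A,\ (j,j')\in J\times J'\}$ of $B\times C$. $f(A)+J$ and $g(A)+J'$ are subrings of $B$ and $C$. The projection to the first coordinate induces a ring isomorphism $A\bowtie^{f,g}(J,J')/(0\times J')\cong f(A)+J$, and $f(A)+J$ is regarded as an $A\bowtie^{f,g}(J,J')$-module through this projection. The module $\operatorname{Hom}_{A\bowtie^{f,g}(J,J')}(f(A)+J,-)$ is an $(f(A)+J)$-module through its first argument, and $J\times 0$ is an $(f(A)+J)$-module by multiplication on the first coordinate. *)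

theory Defs
  imports "HOL-Algebra.Algebra"
begin

section \<open>Modules, linear maps and Hom modules\<close>

definition regular_module :: "('a, 'm) ring_scheme \<Rightarrow> ('a, 'a) module" where
  "regular_module R =
    \<lparr>carrier = carrier R, monoid.mult = monoid.mult R, one = one R,
     ring.zero = ring.zero R, ring.add = ring.add R, smult = monoid.mult R\<rparr>"

definition restrict_scalars ::
    "('r \<Rightarrow> 's) \<Rightarrow> ('s, 'a, 'm) module_scheme \<Rightarrow> ('r, 'a) module" where
  "restrict_scalars \<phi> M =
    \<lparr>carrier = carrier M, monoid.mult = monoid.mult M, one = one M, ring.zero = ring.zero M,
     ring.add = ring.add M, smult = (\<lambda>r x. \<phi> r \<odot>\<^bsub>M\<^esub> x)\<rparr>"

text \<open>Linear maps are taken to be extensional, so that equality of functions on HOL types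
  coincides with equality of maps on the carrier.\<close>

definition linear_maps ::
    "('r, 'm) ring_scheme \<Rightarrow> ('r, 'a, 'n) module_scheme \<Rightarrow> ('r, 'b, 'k) module_scheme
      \<Rightarrow> ('a \<Rightarrow> 'b) set" where
  "linear_maps R M N =
    {h \<in> carrier M \<rightarrow>\<^sub>E carrier N.
      (\<forall>x\<in>carrier M. \<forall>y\<in>carrier M. h (x \<oplus>\<^bsub>M\<^esub> y) = h x \<oplus>\<^bsub>N\<^esub> h y) \<and>
      (\<forall>r\<in>carrier R. \<forall>x\<in>carrier M. h (r \<odot>\<^bsub>M\<^esub> x) = r \<odot>\<^bsub>N\<^esub> h x)}"

definition linear_isos ::
    "('r, 'm) ring_scheme \<Rightarrow> ('r, 'a, 'n) module_scheme \<Rightarrow> ('r, 'b, 'k) module_scheme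
      \<Rightarrow> ('a \<Rightarrow> 'b) set" where
  "linear_isos R M N = {h \<in> linear_maps R M N. bij_betw h (carrier M) (carrier N)}"

definition isomorphic_modules ::
    "('r, 'm) ring_scheme \<Rightarrow> ('r, 'a, 'n) module_scheme \<Rightarrow> ('r, 'b, 'k) module_scheme
      \<Rightarrow> bool" where
  "isomorphic_modules R M N \<longleftrightarrow> linear_isos R M N \<noteq> {}"

text \<open>For a ring homomorphism \<open>\<phi>\<close> from \<open>R\<close> to a commutative ring \<open>S\<close>, an \<open>S\<close>-module \<open>M\<close> and an
  \<open>R\<close>-module \<open>N\<close>, this is the group of \<open>R\<close>-linear maps from \<open>M\<close> (regarded as an \<open>R\<close>-module
  through \<open>\<phi>\<close>) to \<open>N\<close>, with the \<open>S\<close>-action \<open>(s h)(x) = h (s x)\<close> through the first argument.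
  The record type of modules extends that of rings; the ring multiplication and unit carry no
  meaning for a module and are left undefined.\<close>

definition Hom_module ::
    "('r, 'm) ring_scheme \<Rightarrow> ('r \<Rightarrow> 's) \<Rightarrow> ('s, 'a, 'n) module_scheme
      \<Rightarrow> ('r, 'b, 'k) module_scheme \<Rightarrow> ('s, 'a \<Rightarrow> 'b) module" where
  "Hom_module R \<phi> M N =
    \<lparr>carrier = linear_maps R (restrict_scalars \<phi> M) N,
     monoid.mult = undefined, one = undefined,
     ring.zero = (\<lambda>x\<in>carrier M. \<zero>\<^bsub>N\<^esub>),
     ring.add = (\<lambda>h k. \<lambda>x\<in>carrier M. h x \<oplus>\<^bsub>N\<^esub> k x),
     smult = (\<lambda>s h. \<lambda>x\<in>carrier M. h (s \<odot>\<^bsub>M\<^esub> x))\<rparr>"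

definition annihilator :: "('a, 'm) ring_scheme \<Rightarrow> 'a set \<Rightarrow> 'a set" where
  "annihilator R I = {r \<in> carrier R. \<forall>x\<in>I. r \<otimes>\<^bsub>R\<^esub> x = \<zero>\<^bsub>R\<^esub>}"


section \<open>Bi-amalgamations\<close>

text \<open>The subring \<open>f(A) + J\<close> of \<open>B\<close>.\<close>

definition image_plus ::
    "('a, 'm) ring_scheme \<Rightarrow> ('b, 'n) ring_scheme \<Rightarrow> ('a \<Rightarrow> 'b) \<Rightarrow> 'b set
      \<Rightarrow> ('b, 'n) ring_scheme" where
  "image_plus A B f J = B\<lparr>carrier := f ` carrier A <+>\<^bsub>B\<^esub> J\<rparr>"

definition bi_amalgamation ::
    "('a, 'm) ring_scheme \<Rightarrow> ('b, 'n) ring_scheme \<Rightarrow> ('c, 'k) ring_scheme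
      \<Rightarrow> ('a \<Rightarrow> 'b) \<Rightarrow> ('a \<Rightarrow> 'c) \<Rightarrow> 'b set \<Rightarrow> 'c set \<Rightarrow> ('b \<times> 'c) ring" where
  "bi_amalgamation A B C f g J J' =
    (RDirProd B C)\<lparr>carrier :=
      {(f a \<oplus>\<^bsub>B\<^esub> j, g a \<oplus>\<^bsub>C\<^esub> j') | a j j'. a \<in> carrier A \<and> (j, j') \<in> J \<times> J'}\<rparr>"

text \<open>\<open>J \<times> 0\<close>, on which \<open>f(A) + J\<close> acts by multiplication on the first coordinate.\<close>

definition times_zero_module ::
    "('b, 'n) ring_scheme \<Rightarrow> ('c, 'k) ring_scheme \<Rightarrow> 'b set \<Rightarrow> ('b, 'b \<times> 'c) module" where
  "times_zero_module B C J =
    \<lparr>carrier = J \<times> {\<zero>\<^bsub>C\<^esub>}, monoid.mult = undefined, one = undefined,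
     ring.zero = ring.zero (RDirProd B C), ring.add = ring.add (RDirProd B C),
     smult = (\<lambda>d (x, y). (d \<otimes>\<^bsub>B\<^esub> x, y))\<rparr>"


section \<open>The structures are rings and modules\<close>

lemma module_regular_module:
  assumes "cring R"
  shows "module R (regular_module R)"
proof -
  interpret cring R by fact
  show ?thesis
    by (intro moduleI abelian_groupI cring_axioms)
       (auto simp: regular_module_def a_ac l_distr r_distr m_assoc intro: l_neg a_inv_closed)
qed

lemma module_restrict_scalars:
  assumes "cring R" "\<phi> \<in> ring_hom R S" "module S M"
  shows "module R (restrict_scalars \<phi> M)"
proof -
  interpret M: module S M by fact
  note h = ring_hom_closed[OF assms(2)] ring_hom_add[OF assms(2)] ring_hom_mult[OF assms(2)]
    ring_hom_one[OF assms(2)]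
  show ?thesis
    by (intro moduleI abelian_groupI assms(1))
       (auto simp: restrict_scalars_def h M.a_ac M.smult_l_distr M.smult_r_distr
         M.smult_assoc1 intro: M.l_neg M.a_inv_closed)
qed

lemma module_Hom_module:
  assumes "cring R" "\<phi> \<in> ring_hom R S" "module S M" "module R N"
  shows "module S (Hom_module R \<phi> M N)"
proof -
  interpret M: module S M by fact
  interpret N: module R N by fact
  note [simp] = ring_hom_closed[OF assms(2)]
  define H where "H = linear_maps R (restrict_scalars \<phi> M) N"
  have HI: "h \<in> H" if "h \<in> carrier M \<rightarrow>\<^sub>E carrier N"
    "\<And>x y. x \<in> carrier M \<Longrightarrow> y \<in> carrier M \<Longrightarrow> h (x \<oplus>\<^bsub>M\<^esub> y) = h x \<oplus>\<^bsub>N\<^esub> h y"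
    "\<And>r x. r \<in> carrier R \<Longrightarrow> x \<in> carrier M \<Longrightarrow> h (\<phi> r \<odot>\<^bsub>M\<^esub> x) = r \<odot>\<^bsub>N\<^esub> h x" for h
    using that by (auto simp: H_def linear_maps_def restrict_scalars_def)
  have HE: "h \<in> extensional (carrier M)" "x \<in> carrier M \<Longrightarrow> h x \<in> carrier N"
    "x \<in> carrier M \<Longrightarrow> y \<in> carrier M \<Longrightarrow> h (x \<oplus>\<^bsub>M\<^esub> y) = h x \<oplus>\<^bsub>N\<^esub> h y"
    "r \<in> carrier R \<Longrightarrow> x \<in> carrier M \<Longrightarrow> h (\<phi> r \<odot>\<^bsub>M\<^esub> x) = r \<odot>\<^bsub>N\<^esub> h x"
    if "h \<in> H" for h x y r
    using that by (auto simp: H_def linear_maps_def restrict_scalars_def PiE_def)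
  have ext: "h = k" if "h \<in> H" "k \<in> H" "\<And>x. x \<in> carrier M \<Longrightarrow> h x = k x" for h k
    using HE(1)[OF that(1)] HE(1)[OF that(2)] that(3) by (rule extensionalityI)
  have cl_add: "(\<lambda>x\<in>carrier M. h x \<oplus>\<^bsub>N\<^esub> k x) \<in> H" if "h \<in> H" "k \<in> H" for h k
    using that by (intro HI) (auto simp: HE N.smult_r_distr N.a_ac)
  have cl_zero: "(\<lambda>x\<in>carrier M. \<zero>\<^bsub>N\<^esub>) \<in> H"
    by (intro HI) auto
  have cl_neg: "(\<lambda>x\<in>carrier M. \<ominus>\<^bsub>N\<^esub> h x) \<in> H" if "h \<in> H" for h
    using that by (intro HI) (auto simp: HE N.minus_add N.smult_r_minus)
  have cl_smult: "(\<lambda>x\<in>carrier M. h (s \<odot>\<^bsub>M\<^esub> x)) \<in> H" if "h \<in> H" "s \<in> carrier S" for h s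
  proof (intro HI)
    fix r x assume rx: "r \<in> carrier R" "x \<in> carrier M"
    have "s \<odot>\<^bsub>M\<^esub> (\<phi> r \<odot>\<^bsub>M\<^esub> x) = \<phi> r \<odot>\<^bsub>M\<^esub> (s \<odot>\<^bsub>M\<^esub> x)"
      using rx that by (simp add: M.smult_assoc1[symmetric] M.m_comm)
    then show "(\<lambda>x\<in>carrier M. h (s \<odot>\<^bsub>M\<^esub> x)) (\<phi> r \<odot>\<^bsub>M\<^esub> x) =
        r \<odot>\<^bsub>N\<^esub> (\<lambda>x\<in>carrier M. h (s \<odot>\<^bsub>M\<^esub> x)) x"
      using rx that by (simp add: HE)
  qed (use that in \<open>auto simp: HE M.smult_r_distr\<close>)
  have ab: "abelian_group (Hom_module R \<phi> M N)"
  proof (rule abelian_groupI)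
    fix h assume "h \<in> carrier (Hom_module R \<phi> M N)"
    then have h: "h \<in> H" by (simp add: Hom_module_def H_def)
    show "\<exists>k\<in>carrier (Hom_module R \<phi> M N).
        k \<oplus>\<^bsub>Hom_module R \<phi> M N\<^esub> h = \<zero>\<^bsub>Hom_module R \<phi> M N\<^esub>"
      by (rule bexI[of _ "\<lambda>x\<in>carrier M. \<ominus>\<^bsub>N\<^esub> h x"])
         (use h cl_neg[OF h] in \<open>auto simp: Hom_module_def H_def[symmetric] HE N.l_neg
            intro!: restrict_ext\<close>)
  qed (auto simp: Hom_module_def H_def[symmetric] cl_add cl_zero
        cl_add[unfolded restrict_def] cl_zero[unfolded restrict_def] HE N.a_ac
        intro!: ext cl_add cl_zero)
  show ?thesis
    by (rule moduleI[OF M.R.cring_axioms ab])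
       (auto simp: Hom_module_def H_def[symmetric] cl_add cl_smult
          cl_add[unfolded restrict_def] cl_smult[unfolded restrict_def] HE M.smult_l_distr
          M.smult_r_distr M.smult_assoc1[symmetric] M.m_comm intro!: ext cl_add cl_smult)
qed

lemma cring_image_plus:
  assumes "cring A" "cring B" "f \<in> ring_hom A B" "ideal J B"
  shows "cring (image_plus A B f J)"
proof -
  interpret f: ring_hom_cring A B f
    using assms by (simp add: ring_hom_cring_def ring_hom_cring_axioms_def)
  interpret J: ideal J B by fact
  have "subring (f ` carrier A <+>\<^bsub>B\<^esub> J) B"
  proof (rule f.S.subringI)
    show "\<one>\<^bsub>B\<^esub> \<in> f ` carrier A <+>\<^bsub>B\<^esub> J"
      unfolding set_add_def'
      by (auto intro!: exI[of _ "\<one>\<^bsub>A\<^esub>"] bexI[of _ "\<zero>\<^bsub>B\<^esub>"] bexI[of _ "\<one>\<^bsub>A\<^esub>"])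
  next
    fix h assume "h \<in> f ` carrier A <+>\<^bsub>B\<^esub> J"
    then obtain a j where a: "a \<in> carrier A" "j \<in> J" "h = f a \<oplus>\<^bsub>B\<^esub> j"
      unfolding set_add_def' by auto
    moreover have "\<ominus>\<^bsub>B\<^esub> h = f (\<ominus>\<^bsub>A\<^esub> a) \<oplus>\<^bsub>B\<^esub> \<ominus>\<^bsub>B\<^esub> j"
      using a by (simp add: f.S.minus_add)
    ultimately show "\<ominus>\<^bsub>B\<^esub> h \<in> f ` carrier A <+>\<^bsub>B\<^esub> J"
      unfolding set_add_def' by (auto intro!: bexI[of _ "\<ominus>\<^bsub>A\<^esub> a"] bexI[of _ "\<ominus>\<^bsub>B\<^esub> j"])
  next
    fix h k assume "h \<in> f ` carrier A <+>\<^bsub>B\<^esub> J" "k \<in> f ` carrier A <+>\<^bsub>B\<^esub> J"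
    then obtain a j b i where a: "a \<in> carrier A" "j \<in> J" "h = f a \<oplus>\<^bsub>B\<^esub> j"
        "b \<in> carrier A" "i \<in> J" "k = f b \<oplus>\<^bsub>B\<^esub> i"
      unfolding set_add_def' by auto
    have c: "j \<in> carrier B" "i \<in> carrier B" using a by auto
    have "h \<oplus>\<^bsub>B\<^esub> k = f (a \<oplus>\<^bsub>A\<^esub> b) \<oplus>\<^bsub>B\<^esub> (j \<oplus>\<^bsub>B\<^esub> i)"
      using a c by (simp add: f.S.a_ac)
    with a show "h \<oplus>\<^bsub>B\<^esub> k \<in> f ` carrier A <+>\<^bsub>B\<^esub> J"
      unfolding set_add_def'
      by (auto intro!: bexI[of _ "a \<oplus>\<^bsub>A\<^esub> b"] bexI[of _ "j \<oplus>\<^bsub>B\<^esub> i"])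
    have "h \<otimes>\<^bsub>B\<^esub> k = f (a \<otimes>\<^bsub>A\<^esub> b) \<oplus>\<^bsub>B\<^esub> (f a \<otimes>\<^bsub>B\<^esub> i \<oplus>\<^bsub>B\<^esub> j \<otimes>\<^bsub>B\<^esub> k)"
      using a c by (simp add: f.S.a_ac f.S.l_distr f.S.r_distr)
    moreover have "f a \<otimes>\<^bsub>B\<^esub> i \<oplus>\<^bsub>B\<^esub> j \<otimes>\<^bsub>B\<^esub> k \<in> J"
      using a c by (intro J.a_closed J.I_l_closed J.I_r_closed) auto
    ultimately show "h \<otimes>\<^bsub>B\<^esub> k \<in> f ` carrier A <+>\<^bsub>B\<^esub> J"
      using a unfolding set_add_def' by (auto intro!: bexI[of _ "a \<otimes>\<^bsub>A\<^esub> b"])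
  qed (auto simp: set_add_def')
  then show ?thesis
    unfolding image_plus_def
    using f.S.subcring_iff[OF subringE(1)] f.S.subcringI' by blast
qed

lemma cring_bi_amalgamation:
  assumes "cring A" "cring B" "cring C" "f \<in> ring_hom A B" "g \<in> ring_hom A C"
    and "ideal J B" "ideal J' C"
  shows "cring (bi_amalgamation A B C f g J J')"
proof -
  interpret f: ring_hom_cring A B f
    using assms by (simp add: ring_hom_cring_def ring_hom_cring_axioms_def)
  interpret g: ring_hom_cring A C g
    using assms by (simp add: ring_hom_cring_def ring_hom_cring_axioms_def)
  interpret J: ideal J B by fact
  interpret J': ideal J' C by fact
  let ?P = "RDirProd B C"
  let ?H = "{(f a \<oplus>\<^bsub>B\<^esub> j, g a \<oplus>\<^bsub>C\<^esub> j') | a j j'. a \<in> carrier A \<and> (j, j') \<in> J \<times> J'}"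
  interpret P: ring ?P
    using f.S.ring_axioms g.S.ring_axioms by (rule RDirProd_ring)
  have P: "carrier ?P = carrier B \<times> carrier C"
    "\<one>\<^bsub>?P\<^esub> = (\<one>\<^bsub>B\<^esub>, \<one>\<^bsub>C\<^esub>)" "\<zero>\<^bsub>?P\<^esub> = (\<zero>\<^bsub>B\<^esub>, \<zero>\<^bsub>C\<^esub>)"
    "(x, y) \<oplus>\<^bsub>?P\<^esub> (x', y') = (x \<oplus>\<^bsub>B\<^esub> x', y \<oplus>\<^bsub>C\<^esub> y')"
    "(x, y) \<otimes>\<^bsub>?P\<^esub> (x', y') = (x \<otimes>\<^bsub>B\<^esub> x', y \<otimes>\<^bsub>C\<^esub> y')" for x y x' y'
    by (auto simp: RDirProd_def DirProd_def monoid.defs)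
  have cP: "cring ?P"
  proof (rule cring.intro)
    show "comm_monoid ?P"
      by (rule P.monoid_comm_monoidI) (auto simp: P f.S.m_comm g.S.m_comm)
  qed (rule P.ring_axioms)
  have HI: "(x, y) \<in> ?H" if "a \<in> carrier A" "j \<in> J" "j' \<in> J'" "x = f a \<oplus>\<^bsub>B\<^esub> j" "y = g a \<oplus>\<^bsub>C\<^esub> j'"
    for x y a j j'
    using that by blast
  have "subring ?H ?P"
  proof (rule P.subringI)
    show "?H \<subseteq> carrier ?P"
      by (auto simp: P)
    show "\<one>\<^bsub>?P\<^esub> \<in> ?H"
      unfolding P(2) by (rule HI[of "\<one>\<^bsub>A\<^esub>" "\<zero>\<^bsub>B\<^esub>" "\<zero>\<^bsub>C\<^esub>"]) auto
  next
    fix h assume "h \<in> ?H"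
    then obtain a j j' where a: "a \<in> carrier A" "j \<in> J" "j' \<in> J'"
        and h: "h = (f a \<oplus>\<^bsub>B\<^esub> j, g a \<oplus>\<^bsub>C\<^esub> j')"
      by auto
    have c: "j \<in> carrier B" "j' \<in> carrier C" using a by auto
    have "\<ominus>\<^bsub>?P\<^esub> h = (\<ominus>\<^bsub>B\<^esub> (f a \<oplus>\<^bsub>B\<^esub> j), \<ominus>\<^bsub>C\<^esub> (g a \<oplus>\<^bsub>C\<^esub> j'))"
      by (rule P.minus_equality) (use a c in \<open>auto simp: h P f.S.l_neg g.S.l_neg\<close>)
    also have "\<dots> \<in> ?H"
      by (rule HI[of "\<ominus>\<^bsub>A\<^esub> a" "\<ominus>\<^bsub>B\<^esub> j" "\<ominus>\<^bsub>C\<^esub> j'"])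
         (use a c in \<open>auto simp: f.S.minus_add g.S.minus_add\<close>)
    finally show "\<ominus>\<^bsub>?P\<^esub> h \<in> ?H" .
  next
    fix h k assume "h \<in> ?H" "k \<in> ?H"
    then obtain a j j' b i i' where a: "a \<in> carrier A" "j \<in> J" "j' \<in> J'"
        "b \<in> carrier A" "i \<in> J" "i' \<in> J'"
        and h: "h = (f a \<oplus>\<^bsub>B\<^esub> j, g a \<oplus>\<^bsub>C\<^esub> j')" "k = (f b \<oplus>\<^bsub>B\<^esub> i, g b \<oplus>\<^bsub>C\<^esub> i')"
      by auto
    have c: "j \<in> carrier B" "j' \<in> carrier C" "i \<in> carrier B" "i' \<in> carrier C" using a by auto
    show "h \<oplus>\<^bsub>?P\<^esub> k \<in> ?H"
      unfolding h P(4)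
      by (rule HI[of "a \<oplus>\<^bsub>A\<^esub> b" "j \<oplus>\<^bsub>B\<^esub> i" "j' \<oplus>\<^bsub>C\<^esub> i'"])
         (use a c in \<open>auto simp: f.S.a_ac g.S.a_ac\<close>)
    show "h \<otimes>\<^bsub>?P\<^esub> k \<in> ?H"
      unfolding h P(5)
    proof (rule HI[of "a \<otimes>\<^bsub>A\<^esub> b" "f a \<otimes>\<^bsub>B\<^esub> i \<oplus>\<^bsub>B\<^esub> j \<otimes>\<^bsub>B\<^esub> (f b \<oplus>\<^bsub>B\<^esub> i)"
          "g a \<otimes>\<^bsub>C\<^esub> i' \<oplus>\<^bsub>C\<^esub> j' \<otimes>\<^bsub>C\<^esub> (g b \<oplus>\<^bsub>C\<^esub> i')"])
      show "f a \<otimes>\<^bsub>B\<^esub> i \<oplus>\<^bsub>B\<^esub> j \<otimes>\<^bsub>B\<^esub> (f b \<oplus>\<^bsub>B\<^esub> i) \<in> J"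
        using a c by (intro J.a_closed J.I_l_closed J.I_r_closed) auto
      show "g a \<otimes>\<^bsub>C\<^esub> i' \<oplus>\<^bsub>C\<^esub> j' \<otimes>\<^bsub>C\<^esub> (g b \<oplus>\<^bsub>C\<^esub> i') \<in> J'"
        using a c by (intro J'.a_closed J'.I_l_closed J'.I_r_closed) auto
    qed (use a c in \<open>auto simp: f.S.a_ac f.S.l_distr f.S.r_distr g.S.a_ac g.S.l_distr g.S.r_distr\<close>)
  qed
  then show ?thesis
    unfolding bi_amalgamation_def
    using P.subcring_iff[OF subringE(1)] cring.subcringI'[OF cP] by blast
qed

lemma fst_ring_hom_bi_amalgamation:
  "fst \<in> ring_hom (bi_amalgamation A B C f g J J') (image_plus A B f J)"
  unfolding bi_amalgamation_def image_plus_def set_add_def'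
  by (rule ring_hom_memI) (force simp: RDirProd_def DirProd_def monoid.defs)+

lemma module_times_zero_module:
  assumes "cring A" "cring B" "cring C" "f \<in> ring_hom A B" "ideal J B"
  shows "module (image_plus A B f J) (times_zero_module B C J)"
proof -
  interpret f: ring_hom_cring A B f
    using assms by (simp add: ring_hom_cring_def ring_hom_cring_axioms_def)
  interpret C: cring C by fact
  interpret J: ideal J B by fact
  note D = cring_image_plus[OF assms(1,2,4,5)]
  have Dc: "x \<in> carrier B" if "x \<in> f ` carrier A <+>\<^bsub>B\<^esub> J" for x
    using that by (auto simp: set_add_def')
  show ?thesis
    by (intro moduleI abelian_groupI D)
       (auto simp: times_zero_module_def image_plus_def RDirProd_def DirProd_def monoid.defs
         f.S.a_ac f.S.l_distr f.S.r_distr f.S.m_assoc J.I_l_closed Dc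
         intro!: bexI[of _ "\<ominus>\<^bsub>B\<^esub> _"] f.S.l_neg)
qed

end

theory Submission
  imports Defs
begin

text \<open>Evaluation at \<open>1\<close> identifies \<open>Hom\<^sub>R(R/I, R)\<close> with the annihilator of \<open>I\<close> in \<open>R\<close>. For the
  bi-amalgamation and \<open>I = 0 \<times> J'\<close>, an element \<open>(x, y)\<close> kills \<open>I\<close> iff \<open>y\<close> kills \<open>J'\<close>, that is, iff
  \<open>y = 0\<close>; and \<open>(x, 0)\<close> lies in the bi-amalgamation iff \<open>x \<in> J\<close>, because \<open>g\<^sup>-\<^sup>1(J') \<subseteq> f\<^sup>-\<^sup>1(J)\<close>.\<close>

text \<open>The scalar \<open>r\<close> acts on \<open>S\<close> through \<phi>, so
  \<open>\<phi> r\<close> is \<open>r\<close> acting on the unit and linearity pulls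
  \<open>r\<close> out. A linear map is thereby determined on the image of \<phi> by its value at
  the unit.\<close>

lemma linear_maps_regular_apply:
  assumes "cring S" and "\<phi> \<in> ring_hom R S"
    and "h \<in> linear_maps R (restrict_scalars \<phi> (regular_module S)) (regular_module R)"
    and "r \<in> carrier R"
  shows "h (\<phi> r) = r \<otimes>\<^bsub>R\<^esub> h \<one>\<^bsub>S\<^esub>"
proof -
  interpret S: cring S by fact
  have "h (\<phi> r \<otimes>\<^bsub>S\<^esub> \<one>\<^bsub>S\<^esub>) = r \<otimes>\<^bsub>R\<^esub> h \<one>\<^bsub>S\<^esub>"
    using assms(3,4) by (simp add: linear_maps_def restrict_scalars_def regular_module_def)
  then show ?thesis
    using ring_hom_closed[OF assms(2,4)] by simp
qed

text \<open>Surjectivity makes \<open>S\<close> a cyclic \<open>R\<close>-module generated by its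
  unit, with the kernel of \<phi> as its only relations. The unit may therefore be sent to exactly
  those elements of \<open>R\<close> that the kernel kills.\<close>

lemma bij_betw_eval_one:
  assumes "cring R" and "cring S" and "\<phi> \<in> ring_hom R S" and surj: "\<phi> ` carrier R = carrier S"
  shows "bij_betw (\<lambda>h. h \<one>\<^bsub>S\<^esub>)
    (linear_maps R (restrict_scalars \<phi> (regular_module S)) (regular_module R))
    (annihilator R (a_kernel R S \<phi>))"
    (is "bij_betw ?ev ?H ?N")
proof -
  interpret \<phi>: ring_hom_cring R S \<phi>
    using assms by (simp add: ring_hom_cring_def ring_hom_cring_axioms_def)
  have H: "h \<in> extensional (carrier S)" "s \<in> carrier S \<Longrightarrow> h s \<in> carrier R"
    "h \<zero>\<^bsub>S\<^esub> = \<zero>\<^bsub>R\<^esub>" if "h \<in> ?H" for h s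
  proof -
    show cl: "h s \<in> carrier R" if "s \<in> carrier S" for s
      using \<open>h \<in> ?H\<close> that
      by (auto simp: linear_maps_def restrict_scalars_def regular_module_def)
    show "h \<in> extensional (carrier S)"
      using that by (auto simp: linear_maps_def restrict_scalars_def regular_module_def PiE_def)
    \<comment> \<open>This is the case \<open>r = 0\<close> of the formula for
      \<open>h (\<phi> r)\<close>.\<close>
    show "h \<zero>\<^bsub>S\<^esub> = \<zero>\<^bsub>R\<^esub>"
      using linear_maps_regular_apply[OF assms(2,3) that \<phi>.R.zero_closed] cl by simp
  qed
  note ap = linear_maps_regular_apply[OF assms(2,3)]
  have "inj_on ?ev ?H"
  proof (rule inj_onI)
    fix h k assume hk: "h \<in> ?H" "k \<in> ?H" "h \<one>\<^bsub>S\<^esub> = k \<one>\<^bsub>S\<^esub>"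
    show "h = k"
    proof (rule extensionalityI[OF H(1)[OF hk(1)] H(1)[OF hk(2)]])
      fix s assume "s \<in> carrier S"
      then obtain r where "r \<in> carrier R" "s = \<phi> r"
        using surj by blast
      then show "h s = k s"
        using ap[OF hk(1)] ap[OF hk(2)] hk(3) by simp
    qed
  qed
  moreover have "?ev ` ?H \<subseteq> ?N"
  proof (rule image_subsetI)
    fix h assume h: "h \<in> ?H"
    \<comment> \<open>For \<open>r\<close> in the kernel, \<open>r\<close> times the value at the
      unit is \<open>h (\<phi> r) = h 0 = 0\<close>; commutativity then gives the order of factors
      used in \<open>annihilator\<close>.\<close>
    have "h \<one>\<^bsub>S\<^esub> \<otimes>\<^bsub>R\<^esub> r = \<zero>\<^bsub>R\<^esub>" if r: "r \<in> a_kernel R S \<phi>" for r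
    proof -
      have rc: "r \<in> carrier R" and "\<phi> r = \<zero>\<^bsub>S\<^esub>"
        using r unfolding a_kernel_def' by blast+
      then have "r \<otimes>\<^bsub>R\<^esub> h \<one>\<^bsub>S\<^esub> = \<zero>\<^bsub>R\<^esub>"
        using ap[OF h rc] H(3)[OF h] by simp
      then show ?thesis
        using \<phi>.R.m_comm[OF rc H(2)[OF h \<phi>.S.one_closed]] by simp
    qed
    then show "h \<one>\<^bsub>S\<^esub> \<in> ?N"
      using H(2)[OF h \<phi>.S.one_closed] by (simp add: annihilator_def)
  qed
  moreover have "?N \<subseteq> ?ev ` ?H"
  proof
    fix u assume u: "u \<in> ?N"
    have uc: "u \<in> carrier R"
      using u by (simp add: annihilator_def)
    \<comment> \<open>Two preimages of the same element differ by an element of the kernel, which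
      \<open>u\<close> kills.\<close>
    have well_defined: "r \<otimes>\<^bsub>R\<^esub> u = r' \<otimes>\<^bsub>R\<^esub> u"
      if r: "r \<in> carrier R" "r' \<in> carrier R" "\<phi> r = \<phi> r'" for r r'
    proof -
      have "r \<ominus>\<^bsub>R\<^esub> r' \<in> a_kernel R S \<phi>"
        using r unfolding a_kernel_def' by (simp add: \<phi>.R.minus_eq \<phi>.S.r_neg)
      then have "(r \<ominus>\<^bsub>R\<^esub> r') \<otimes>\<^bsub>R\<^esub> u = \<zero>\<^bsub>R\<^esub>"
        using u r uc by (simp add: annihilator_def \<phi>.R.m_comm)
      then have "r \<otimes>\<^bsub>R\<^esub> u \<ominus>\<^bsub>R\<^esub> r' \<otimes>\<^bsub>R\<^esub> u = \<zero>\<^bsub>R\<^esub>"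
        using r uc by (simp add: \<phi>.R.minus_eq \<phi>.R.l_distr \<phi>.R.l_minus)
      then show ?thesis
        using r uc by simp
    qed
    \<comment> \<open>The map \<open>\<phi> r \<mapsto> r u\<close>, written with a chosen preimage;
      \<open>well_defined\<close> makes the choice immaterial. It is restricted to the carrier
      because linear maps are extensional.\<close>
    define h where "h = (\<lambda>s\<in>carrier S. inv_into (carrier R) \<phi> s \<otimes>\<^bsub>R\<^esub> u)"
    have h: "h (\<phi> r) = r \<otimes>\<^bsub>R\<^esub> u" if "r \<in> carrier R" for r
    proof -
      have "inv_into (carrier R) \<phi> (\<phi> r) \<otimes>\<^bsub>R\<^esub> u = r \<otimes>\<^bsub>R\<^esub> u"
        using that by (intro well_defined) (simp_all add: inv_into_into f_inv_into_f)
      then show ?thesis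
        using that by (simp add: h_def)
    qed
    have "h \<in> ?H"
    proof -
      \<comment> \<open>By surjectivity it is enough to test linearity on elements of the form
        \<open>\<phi> r'\<close>.\<close>
      have "h (\<phi> r \<oplus>\<^bsub>S\<^esub> \<phi> r') = h (\<phi> r) \<oplus>\<^bsub>R\<^esub> h (\<phi> r')"
        "h (\<phi> r \<otimes>\<^bsub>S\<^esub> \<phi> r') = r \<otimes>\<^bsub>R\<^esub> h (\<phi> r')"
        if r: "r \<in> carrier R" "r' \<in> carrier R" for r r'
        using h[of "r \<oplus>\<^bsub>R\<^esub> r'"] h[of "r \<otimes>\<^bsub>R\<^esub> r'"] r uc
        by (simp_all add: h \<phi>.R.l_distr \<phi>.R.m_assoc)
      moreover have "h \<in> carrier S \<rightarrow>\<^sub>E carrier R"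
        using uc by (auto simp: h_def surj[symmetric] intro: inv_into_into)
      ultimately show ?thesis
        by (auto simp: linear_maps_def restrict_scalars_def regular_module_def surj[symmetric])
    qed
    moreover have "h \<one>\<^bsub>S\<^esub> = u"
      using h[OF \<phi>.R.one_closed] uc by simp
    ultimately show "u \<in> ?ev ` ?H"
      by blast
  qed
  ultimately show ?thesis
    unfolding bij_betw_def by (intro conjI subset_antisym)
qed

lemma bi_amalgamation_memI:
  assumes "a \<in> carrier A" and "j \<in> J" and "j' \<in> J'"
    and "x = f a \<oplus>\<^bsub>B\<^esub> j" and "y = g a \<oplus>\<^bsub>C\<^esub> j'"
  shows "(x, y) \<in> carrier (bi_amalgamation A B C f g J J')"
  using assms by (auto simp: bi_amalgamation_def)

lemma bi_amalgamation_memE: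
  assumes "(x, y) \<in> carrier (bi_amalgamation A B C f g J J')"
  obtains a j j' where "a \<in> carrier A" and "j \<in> J" and "j' \<in> J'"
    and "x = f a \<oplus>\<^bsub>B\<^esub> j" and "y = g a \<oplus>\<^bsub>C\<^esub> j'"
  using assms by (auto simp: bi_amalgamation_def)

lemma bi_amalgamation_simps:
  "\<zero>\<^bsub>bi_amalgamation A B C f g J J'\<^esub> = (\<zero>\<^bsub>B\<^esub>, \<zero>\<^bsub>C\<^esub>)"
  "(x, y) \<oplus>\<^bsub>bi_amalgamation A B C f g J J'\<^esub> (x', y') = (x \<oplus>\<^bsub>B\<^esub> x', y \<oplus>\<^bsub>C\<^esub> y')"
  "(x, y) \<otimes>\<^bsub>bi_amalgamation A B C f g J J'\<^esub> (x', y') = (x \<otimes>\<^bsub>B\<^esub> x', y \<otimes>\<^bsub>C\<^esub> y')"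
  by (auto simp: bi_amalgamation_def RDirProd_def DirProd_def monoid.defs)

text \<open>Supplies the surjectivity needed to apply \<open>bij_betw_eval_one\<close> to
  \<open>fst\<close>.\<close>

lemma fst_image_bi_amalgamation:
  assumes "ideal J' C"
  shows "fst ` carrier (bi_amalgamation A B C f g J J') = carrier (image_plus A B f J)"
proof -
  interpret J': ideal J' C by fact
  show ?thesis
  proof (rule subset_antisym; rule subsetI)
    fix x assume "x \<in> fst ` carrier (bi_amalgamation A B C f g J J')"
    then obtain a j where "a \<in> carrier A" "j \<in> J" "x = f a \<oplus>\<^bsub>B\<^esub> j"
      by (auto elim: bi_amalgamation_memE)
    then show "x \<in> carrier (image_plus A B f J)"
      by (auto simp: image_plus_def set_add_def')
  next
    fix x assume "x \<in> carrier (image_plus A B f J)"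
    then obtain a j where a: "a \<in> carrier A" "j \<in> J" "x = f a \<oplus>\<^bsub>B\<^esub> j"
      by (auto simp: image_plus_def set_add_def')
    \<comment> \<open>The lift of \<open>f a + j\<close> with second coordinate \<open>g a\<close>,
      obtained by taking \<open>j' = 0\<close>.\<close>
    have "(x, g a \<oplus>\<^bsub>C\<^esub> \<zero>\<^bsub>C\<^esub>) \<in> carrier (bi_amalgamation A B C f g J J')"
      using a(1,2) additive_subgroup.zero_closed[OF J'.additive_subgroup_axioms] a(3) refl by (rule bi_amalgamation_memI)
    then show "x \<in> fst ` carrier (bi_amalgamation A B C f g J J')"
      by (rule image_eqI[rotated]) simp
  qed
qed

text \<open>An element killing the kernel kills \<open>0 \<times> J'\<close> in particular, so the
  annihilator hypothesis forces its second coordinate to vanish; the preimage inclusion then puts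
  its first coordinate in \<open>J\<close>. Conversely, \<open>(x, 0)\<close> times any
  \<open>(0, y)\<close> is zero.\<close>

lemma annihilator_ker_fst:
  assumes "cring A" and "cring B" and "cring C"
    and "f \<in> ring_hom A B" and "g \<in> ring_hom A C"
    and "ideal J B" and "ideal J' C"
    and preimage: "{a \<in> carrier A. g a \<in> J'} \<subseteq> {a \<in> carrier A. f a \<in> J}"
    and ann: "annihilator (image_plus A C g J') J' = {\<zero>\<^bsub>C\<^esub>}"
  defines "R \<equiv> bi_amalgamation A B C f g J J'"
  shows "annihilator R (a_kernel R (image_plus A B f J) fst) = J \<times> {\<zero>\<^bsub>C\<^esub>}"
proof -
  interpret f: ring_hom_cring A B f
    using assms by (simp add: ring_hom_cring_def ring_hom_cring_axioms_def)
  interpret g: ring_hom_cring A C g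
    using assms by (simp add: ring_hom_cring_def ring_hom_cring_axioms_def)
  interpret J: ideal J B by fact
  interpret J': ideal J' C by fact
  have ker: "p \<in> a_kernel R (image_plus A B f J) fst \<longleftrightarrow> p \<in> carrier R \<and> fst p = \<zero>\<^bsub>B\<^esub>" for p
    unfolding a_kernel_def' by (simp add: image_plus_def)
  note R_simps = bi_amalgamation_simps[of A B C f g J J', folded R_def]
  have R_carrier: "x \<in> carrier B" "y \<in> carrier C" if "(x, y) \<in> carrier R" for x y
    using that unfolding R_def by (auto elim!: bi_amalgamation_memE)
  have "x \<in> J \<and> y = \<zero>\<^bsub>C\<^esub>" if xy: "(x, y) \<in> annihilator R (a_kernel R (image_plus A B f J) fst)"
    for x y
  proof -
    have "(x, y) \<in> carrier R"
      using xy by (simp add: annihilator_def)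
    then obtain a j j' where a: "a \<in> carrier A" "j \<in> J" "j' \<in> J'"
        "x = f a \<oplus>\<^bsub>B\<^esub> j" "y = g a \<oplus>\<^bsub>C\<^esub> j'"
      unfolding R_def by (rule bi_amalgamation_memE)
    have "y \<otimes>\<^bsub>C\<^esub> i = \<zero>\<^bsub>C\<^esub>" if "i \<in> J'" for i
    proof -
      \<comment> \<open>Multiplying by the kernel element \<open>(0, i)\<close> isolates the second
        coordinate; it lies in \<open>R\<close> by the choice \<open>a = 0\<close>,
        \<open>j = 0\<close>.\<close>
      have "(\<zero>\<^bsub>B\<^esub>, i) \<in> carrier R"
        unfolding R_def using that
        by (intro bi_amalgamation_memI[of "\<zero>\<^bsub>A\<^esub>" _ "\<zero>\<^bsub>B\<^esub>" _ i]) auto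
      then have "(x, y) \<otimes>\<^bsub>R\<^esub> (\<zero>\<^bsub>B\<^esub>, i) = \<zero>\<^bsub>R\<^esub>"
        using xy by (simp add: annihilator_def ker)
      then show ?thesis
        by (simp add: R_simps)
    qed
    moreover have "y \<in> carrier (image_plus A C g J')"
      using a by (auto simp: image_plus_def set_add_def')
    ultimately have "y \<in> annihilator (image_plus A C g J') J'"
      by (simp add: annihilator_def image_plus_def)
    then have y: "y = \<zero>\<^bsub>C\<^esub>"
      using ann by simp
    \<comment> \<open>As \<open>g a + j' = 0\<close>, the element \<open>g a\<close> lies in
      \<open>J'\<close>; the preimage inclusion gives \<open>f a \<in> J\<close>, whence
      \<open>x = f a + j\<close> lies in \<open>J\<close>.\<close>
    then have "g a = \<ominus>\<^bsub>C\<^esub> j'"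
      using a by (metis g.S.minus_equality g.hom_closed J'.Icarr)
    then have "f a \<in> J"
      using a preimage by auto
    then show ?thesis
      using a y by auto
  qed
  moreover have "(x, \<zero>\<^bsub>C\<^esub>) \<in> annihilator R (a_kernel R (image_plus A B f J) fst)"
    if x: "x \<in> J" for x
  proof -
    have "(x, \<zero>\<^bsub>C\<^esub>) \<in> carrier R"
      unfolding R_def using x
      by (intro bi_amalgamation_memI[of "\<zero>\<^bsub>A\<^esub>" _ x _ "\<zero>\<^bsub>C\<^esub>"]) auto
    then show ?thesis
      using x R_carrier by (auto simp: annihilator_def ker R_simps)
  qed
  ultimately show ?thesis
    by auto
qed

theorem lemma3p1:
  fixes A :: "('a, 'm) ring_scheme" and B :: "('b, 'n) ring_scheme" and C :: "('c, 'k) ring_scheme"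
    and f :: "'a \<Rightarrow> 'b" and g :: "'a \<Rightarrow> 'c" and J :: "'b set" and J' :: "'c set"
  assumes "cring A" and "cring B" and "cring C"
    and "f \<in> ring_hom A B" and "g \<in> ring_hom A C"
    and "ideal J B" and "ideal J' C"
    and "{a \<in> carrier A. f a \<in> J} = {a \<in> carrier A. g a \<in> J'}"
    and "annihilator (image_plus A C g J') J' = {\<zero>\<^bsub>C\<^esub>}"
  shows "isomorphic_modules (image_plus A B f J)
    (Hom_module (bi_amalgamation A B C f g J J') fst
      (regular_module (image_plus A B f J))
      (regular_module (bi_amalgamation A B C f g J J')))
    (times_zero_module B C J)"
proof -
  let ?R = "bi_amalgamation A B C f g J J'" and ?S = "image_plus A B f J"
  let ?M = "Hom_module ?R fst (regular_module ?S) (regular_module ?R)"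
  have R: "cring ?R"
    using assms by (intro cring_bi_amalgamation)
  have S: "cring ?S"
    using assms by (intro cring_image_plus)
  interpret S: cring ?S by (rule S)
  interpret C: cring C by fact
  note fst = fst_ring_hom_bi_amalgamation[of A B C f g J J']
  have M: "carrier ?M = linear_maps ?R (restrict_scalars fst (regular_module ?S)) (regular_module ?R)"
    by (simp add: Hom_module_def)
  \<comment> \<open>The two lemmas combine: maps correspond to elements killing the kernel of
    \<open>fst\<close>, and these form \<open>J \<times> 0\<close>.\<close>
  have bij: "bij_betw (\<lambda>h. h \<one>\<^bsub>?S\<^esub>) (carrier ?M) (J \<times> {\<zero>\<^bsub>C\<^esub>})"
    using bij_betw_eval_one[OF R S fst fst_image_bi_amalgamation[OF assms(7)]]
      annihilator_ker_fst[OF assms(1-7) _ assms(9)] assms(8)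
    by (simp add: M)
  have M_module: "module ?S ?M"
    using R S fst by (intro module_Hom_module module_regular_module)
  interpret M: module ?S ?M by (rule M_module)
  \<comment> \<open>Evaluation at the unit, cut down to the carrier of \<open>?M\<close> so that it
    is extensional as \<open>linear_maps\<close> demands.\<close>
  let ?e = "\<lambda>h\<in>carrier ?M. h \<one>\<^bsub>?S\<^esub>"
  have add: "?e (h \<oplus>\<^bsub>?M\<^esub> k) = ?e h \<oplus>\<^bsub>times_zero_module B C J\<^esub> ?e k"
    if "h \<in> carrier ?M" "k \<in> carrier ?M" for h k
  proof -
    have "(h \<oplus>\<^bsub>?M\<^esub> k) \<one>\<^bsub>?S\<^esub> = h \<one>\<^bsub>?S\<^esub> \<oplus>\<^bsub>?R\<^esub> k \<one>\<^bsub>?S\<^esub>"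
      by (simp add: Hom_module_def regular_module_def)
    also have "\<dots> = h \<one>\<^bsub>?S\<^esub> \<oplus>\<^bsub>times_zero_module B C J\<^esub> k \<one>\<^bsub>?S\<^esub>"
      \<comment> \<open>Both additions are inherited from \<open>RDirProd B C\<close>.\<close>
      by (simp add: times_zero_module_def bi_amalgamation_def)
    finally show ?thesis
      using that M.a_closed[OF that] by (simp only: restrict_apply if_True)
  qed
  have smult: "?e (s \<odot>\<^bsub>?M\<^esub> h) = s \<odot>\<^bsub>times_zero_module B C J\<^esub> ?e h"
    if s: "s \<in> carrier ?S" and h: "h \<in> carrier ?M" for s h
  proof -
    \<comment> \<open>The maps in \<open>?M\<close> are linear over \<open>?R\<close>, so the scalar
      \<open>s\<close> of \<open>?S\<close> is lifted to \<open>(s, t)\<close>. Then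
      \<open>s\<close> acting on \<open>h\<close> has value
      \<open>h s = (s, t) (x, 0) = (s x, 0)\<close> at the unit, and the choice of \<open>t\<close>
      does not affect the result.\<close>
    obtain t where t: "(s, t) \<in> carrier ?R"
      using s fst_image_bi_amalgamation[OF assms(7), of A B f g J] by force
    obtain x where x: "h \<one>\<^bsub>?S\<^esub> = (x, \<zero>\<^bsub>C\<^esub>)"
      using bij_betwE[OF bij] h by blast
    have "t \<in> carrier C"
      using t ring_hom_closed[OF assms(5)] ideal.Icarr[OF assms(7)]
      by (auto elim!: bi_amalgamation_memE)
    moreover have "(s \<odot>\<^bsub>?M\<^esub> h) \<one>\<^bsub>?S\<^esub> = h s"
      using s S.r_one[OF s] by (simp add: Hom_module_def regular_module_def)
    moreover have "h s = (s, t) \<otimes>\<^bsub>?R\<^esub> h \<one>\<^bsub>?S\<^esub>"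
      using linear_maps_regular_apply[OF S fst h[unfolded M] t] by simp
    ultimately show ?thesis
      using s h M.smult_closed[OF s h]
      by (simp add: x bi_amalgamation_simps times_zero_module_def)
  qed
  have "?e \<in> carrier ?M \<rightarrow>\<^sub>E carrier (times_zero_module B C J)"
    using bij by (auto simp: bij_betw_def times_zero_module_def)
  moreover have "bij_betw ?e (carrier ?M) (carrier (times_zero_module B C J))"
    using bij by (subst bij_betw_cong[where g = "\<lambda>h. h \<one>\<^bsub>?S\<^esub>"])
      (simp_all add: times_zero_module_def)
  ultimately have "?e \<in> linear_isos ?S ?M (times_zero_module B C J)"
    using add smult by (simp only: linear_isos_def linear_maps_def mem_Collect_eq) blast
  then show ?thesis
    by (auto simp: isomorphic_modules_def)
qed

end
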